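(* Let $\mathcal{A}$ be a strongly connected $d$-dimensional VASS with at least one transition, and assume that on input $\mathcal{A}$ Algorithm 1 (described in the context) returns a tuple $(k,\mathit{tight})\in\mathbb{N}\times\{\mathit{true},\mathit{false}\}$. Then $k\in\{1,\dots,d\}$ and $\mathcal{A}$ is terminating. Moreover, if $\mathit{tight}=\mathit{true}$, then $\mathcal{L}(n)\in\mathcal{O}(n^k)$.
   Context: A $d$-dimensional VASS is a pair $\mathcal{A}=(Q,T)$ with $Q$ a finite nonempty set of states and $T\subseteq Q\times\mathbb{Z}^d\times Q$ a finite set of transitions such that every state has an outgoing transition. A configuration is $p\mathbf{v}$ with $p\in Q$, $\mathbf{v}\in\mathbb{N}^d$, of size $\max_i\mathbf{v}(i)$. A computation from $p_0\mathbf{v}_0$ is a sequence of configurations $p_0\mathbf{v}_0,\dots,p_n\mathbf{v}_n$ (vectors in $\mathbb{N}^d$) with transitions $(p_i,\mathbf{u}_{i+1},p_{i+1})\in T$ and $\mathbf{v}_{i+1}=\mathbf{v}_i+\mathbf{u}_{i+1}$; length $n$. $L(p\mathbf{v})\in\mathbb{N}\cup\{\infty\}$ is the least bound on lengths of computations from $p\mathbf{v}$; $\mathcal{L}(n)=\sup\{L(p\mathbf{v}):\text{size}(p\mathbf{v})=n\}$; $\mathcal{A}$ is terminating if $\mathcal{L}(n)<\infty$ for all $n$. $g\in\mathcal{O}(h)$ means $g(n)\le a\,h(n)$ for some constant $a>0$ and all sufficiently large $n$. A sub-VASS is a VASS $(Q',T')$ with $Q'\subseteq Q$, $T'\subseteq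 T$; strongly connected means a nonempty path between any two states; an SCC of a graph $(Q,T')$ is a maximal strongly connected sub-VASS of it. A linear map is $f(p\mathbf{v})=\mathbf{c}_f^\top\mathbf{v}+\mathbf{w}_f(p)$ with $\mathbf{c}_f\in\mathbb{Q}^d$, $\mathbf{w}_f\in\mathbb{Q}^Q$; a transition $(p,\mathbf{u},q)$ is $f$-ranked if $\mathbf{c}_f^\top\mathbf{u}+\mathbf{w}_f(q)\le\mathbf{w}_f(p)-1$ and $f$-neutral if $\mathbf{c}_f^\top\mathbf{u}+\mathbf{w}_f(q)=\mathbf{w}_f(p)$. A QRF is a linear map with $\mathbf{c}_f\ge\vec0$ such that every transition is $f$-ranked or $f$-neutral; positive if $\mathbf{c}_f>\vec0$. Algorithm 1: set $\mathit{tight}:=\mathit{true}$ iff a positive QRF for $\mathcal{A}$ exists; $k:=\mathrm{Decompose}(\mathcal{A})$; if $k=\infty$ return "non-terminating", else return $(k,\mathit{tight})$. $\mathrm{Decompose}(\mathcal{A})$: pick a QRF $f$ maximizing the number of $f$-ranked transitions; $T_f:=$ set of $f$-neutral transitions; if $T_f$ contains all transitions return $\infty$; if $T_f=\emptyset$ return $1$; otherwise with $\mathcal{A}_1,\dots,\mathcal{A}_\ell$ all SCCs of $(Q,T_f)$ return $1+\max_i\mathrm{Decompose}(\mathcal{A}_i)$. *)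

theory Defs
  imports "HOL-Analysis.Analysis"
begin

text \<open>The dimension \<open>d\<close> is \<open>CARD('d)\<close> for a finite index type \<open>'d\<close>. A pair \<open>(Q, T)\<close> also serves as a
  plain labelled graph, for which the conditions in \<open>is_vass\<close> need not hold.\<close>

type_synonym ('q, 'd) transition = "'q \<times> (int, 'd) vec \<times> 'q"
type_synonym ('q, 'd) vass = "'q set \<times> ('q, 'd) transition set"
type_synonym ('q, 'd) configuration = "'q \<times> (nat, 'd) vec"

abbreviation states :: "('q, 'd) vass \<Rightarrow> 'q set" where
  "states A \<equiv> fst A"

abbreviation transitions :: "('q, 'd) vass \<Rightarrow> ('q, 'd) transition set" where
  "transitions A \<equiv> snd A"

definition is_vass :: "('q, 'd::finite) vass \<Rightarrow> bool" where
  "is_vass A \<longleftrightarrow>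
     finite (states A) \<and> states A \<noteq> {} \<and>
     transitions A \<subseteq> states A \<times> UNIV \<times> states A \<and> finite (transitions A) \<and>
     (\<forall>p\<in>states A. \<exists>u q. (p, u, q) \<in> transitions A)"

definition edges :: "('q, 'd::finite) vass \<Rightarrow> ('q \<times> 'q) set" where
  "edges A = {(p, q). \<exists>u. (p, u, q) \<in> transitions A}"

definition strongly_connected :: "('q, 'd::finite) vass \<Rightarrow> bool" where
  "strongly_connected A \<longleftrightarrow> (\<forall>p\<in>states A. \<forall>q\<in>states A. (p, q) \<in> (edges A)\<^sup>+)"

definition sub_vass :: "('q, 'd::finite) vass \<Rightarrow> ('q, 'd) vass \<Rightarrow> bool" where
  "sub_vass B G \<longleftrightarrow> is_vass B \<and> states B \<subseteq> states G \<and> transitions B \<subseteq> transitions G"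

definition sccs :: "('q, 'd::finite) vass \<Rightarrow> ('q, 'd) vass set" where
  "sccs G = {B. sub_vass B G \<and> strongly_connected B \<and>
     (\<forall>C. sub_vass C G \<and> strongly_connected C \<and>
          states B \<subseteq> states C \<and> transitions B \<subseteq> transitions C \<longrightarrow> C = B)}"

definition conf_size :: "('q, 'd::finite) configuration \<Rightarrow> nat" where
  "conf_size c = Max (range (\<lambda>i. snd c $ i))"

definition step :: "('q, 'd::finite) vass \<Rightarrow> ('q, 'd) configuration \<Rightarrow> ('q, 'd) configuration \<Rightarrow> bool" where
  "step A c c' \<longleftrightarrow> (\<exists>u. (fst c, u, fst c') \<in> transitions A \<and>
     (\<forall>i. int (snd c' $ i) = int (snd c $ i) + u $ i))"

text \<open>A computation of length \<open>n\<close> is a list of \<open>n + 1\<close> configurations.\<close>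

definition computation ::
  "('q, 'd::finite) vass \<Rightarrow> ('q, 'd) configuration \<Rightarrow> nat \<Rightarrow> ('q, 'd) configuration list \<Rightarrow> bool" where
  "computation A c n cs \<longleftrightarrow>
     length cs = Suc n \<and> cs ! 0 = c \<and> (\<forall>x\<in>set cs. fst x \<in> states A) \<and>
     (\<forall>i<n. step A (cs ! i) (cs ! Suc i))"

definition termination_time :: "('q, 'd::finite) vass \<Rightarrow> ('q, 'd) configuration \<Rightarrow> enat" where
  "termination_time A c = Sup {enat n |n. \<exists>cs. computation A c n cs}"

definition termination_complexity :: "('q, 'd::finite) vass \<Rightarrow> nat \<Rightarrow> enat" where
  "termination_complexity A n =
     Sup {termination_time A c |c. fst c \<in> states A \<and> conf_size c = n}"

definition terminating :: "('q, 'd::finite) vass \<Rightarrow> bool" where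
  "terminating A \<longleftrightarrow> (\<forall>n. termination_complexity A n < \<infinity>)"

text \<open>The Landau symbol of the library requires values in a normed field; this is the same notion for
  functions that may take the value \<open>\<infinity>\<close>.\<close>

definition in_bigo :: "(nat \<Rightarrow> enat) \<Rightarrow> (nat \<Rightarrow> real) \<Rightarrow> bool" where
  "in_bigo g h \<longleftrightarrow>
     (\<exists>a>0. eventually (\<lambda>n. ereal_of_enat (g n) \<le> ereal (a * h n)) sequentially)"

text \<open>The linear map \<open>p v \<mapsto> c\<^sup>T v + w p\<close> is represented by the pair \<open>(c, w)\<close>; only the values of \<open>w\<close>
  on the states of the VASS at hand matter.\<close>

type_synonym ('q, 'd) linear_map = "(rat, 'd) vec \<times> ('q \<Rightarrow> rat)"

definition dot :: "(rat, 'd::finite) vec \<Rightarrow> (int, 'd) vec \<Rightarrow> rat" where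
  "dot c u = (\<Sum>i\<in>UNIV. c $ i * of_int (u $ i))"

definition ranked :: "('q, 'd::finite) linear_map \<Rightarrow> ('q, 'd) transition \<Rightarrow> bool" where
  "ranked f = (\<lambda>(p, u, q). dot (fst f) u + snd f q \<le> snd f p - 1)"

definition neutral :: "('q, 'd::finite) linear_map \<Rightarrow> ('q, 'd) transition \<Rightarrow> bool" where
  "neutral f = (\<lambda>(p, u, q). dot (fst f) u + snd f q = snd f p)"

definition qrf :: "('q, 'd::finite) vass \<Rightarrow> ('q, 'd) linear_map \<Rightarrow> bool" where
  "qrf A f \<longleftrightarrow> (\<forall>i. 0 \<le> fst f $ i) \<and> (\<forall>t\<in>transitions A. ranked f t \<or> neutral f t)"

definition positive_qrf :: "('q, 'd::finite) vass \<Rightarrow> ('q, 'd) linear_map \<Rightarrow> bool" where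
  "positive_qrf A f \<longleftrightarrow> qrf A f \<and> (\<forall>i. 0 < fst f $ i)"

definition ranked_transitions ::
  "('q, 'd::finite) vass \<Rightarrow> ('q, 'd) linear_map \<Rightarrow> ('q, 'd) transition set" where
  "ranked_transitions A f = {t \<in> transitions A. ranked f t}"

definition neutral_transitions ::
  "('q, 'd::finite) vass \<Rightarrow> ('q, 'd) linear_map \<Rightarrow> ('q, 'd) transition set" where
  "neutral_transitions A f = {t \<in> transitions A. neutral f t}"

definition maximal_qrf :: "('q, 'd::finite) vass \<Rightarrow> ('q, 'd) linear_map \<Rightarrow> bool" where
  "maximal_qrf A f \<longleftrightarrow> qrf A f \<and>
     (\<forall>g. qrf A g \<longrightarrow> card (ranked_transitions A g) \<le> card (ranked_transitions A f))"

text \<open>\<open>decompose A k\<close> holds if some run of the recursive procedure on \<open>A\<close> returns \<open>k\<close>; the choice of the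
  maximal quasi-ranking function is the only source of nondeterminism. In the last rule, \<open>K B\<close> is the
  value returned by the recursive call on \<open>B\<close>, and the supremum is the maximum of these values.\<close>

inductive decompose :: "('q, 'd::finite) vass \<Rightarrow> enat \<Rightarrow> bool" where
  infinite: "decompose A \<infinity>"
    if "maximal_qrf A f" "neutral_transitions A f = transitions A"
| one: "decompose A 1"
    if "maximal_qrf A f" "neutral_transitions A f \<noteq> transitions A" "neutral_transitions A f = {}"
| recurse: "decompose A (1 + (SUP B\<in>sccs (states A, neutral_transitions A f). K B))"
    if "maximal_qrf A f" "neutral_transitions A f \<noteq> transitions A" "neutral_transitions A f \<noteq> {}"
       "\<forall>B\<in>sccs (states A, neutral_transitions A f). decompose B (K B)"

datatype answer = Nonterminating | Bound nat bool

definition algorithm_returns :: "('q, 'd::finite) vass \<Rightarrow> answer \<Rightarrow> bool" where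
  "algorithm_returns A r \<longleftrightarrow> (\<exists>k. decompose A k \<and>
     r = (case k of enat m \<Rightarrow> Bound m (\<exists>f. positive_qrf A f) | \<infinity> \<Rightarrow> Nonterminating))"

end

theory Submission
  imports Defs
begin

text \<open>Let \<open>f\<close> be the quasi-ranking function chosen for \<open>A\<close>. Rounding \<open>f\<close> down, shifted to be
  nonnegative, gives a natural-number potential of size linear in the configuration that is constant
  along neutral transitions and decreases along ranked ones. Combined lexicographically with the number
  of states reachable by neutral transitions, it also decreases along neutral transitions between
  different SCCs. Hence a computation consists of linearly many segments, each inside one SCC of the
  neutral graph. Inductively these segments are bounded in terms of the configuration they start from,
  which yields termination. A positive quasi-ranking function keeps all reachable configurations of
  linear size and is inherited by the SCCs, so each level of the recursion contributes one factor \<open>n\<close>.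

  For the bound on \<open>k\<close>, consider the linear functionals that vanish on all cycles of \<open>A\<close>. The
  coefficients of \<open>f\<close> are not among them, as \<open>f\<close> ranks some transition and every transition lies on a
  cycle, but they vanish on all cycles of every SCC of the neutral graph. So the dimension of this space
  grows with each level of the recursion.\<close>

section \<open>Bounds on run lengths in abstract relations\<close>

text \<open>Only the start of a run is required to lie in \<open>X\<close>. A union argument that
  restarts the bound in the middle of a run therefore needs control of where the run has got to, by
  a growth rate or by an invariant.\<close>

definition bounded_runs :: "('c \<times> 'c) set \<Rightarrow> 'c set \<Rightarrow> nat \<Rightarrow> bool" where
  "bounded_runs R X l \<longleftrightarrow> (\<forall>c\<in>X. \<forall>c' m. (c, c') \<in> R ^^ m \<longrightarrow> m \<le> l)"

lemma bounded_runsD: "bounded_runs R X l \<Longrightarrow> c \<in> X \<Longrightarrow> (c, c') \<in> R ^^ m \<Longrightarrow> m \<le> l"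
  unfolding bounded_runs_def by blast

lemma bounded_runs_mono: "bounded_runs R X l \<Longrightarrow> l \<le> l' \<Longrightarrow> bounded_runs R X l'"
  unfolding bounded_runs_def by (meson order_trans)

text \<open>Cuts a run at its first \<open>S\<close>-step. Both inductions on a potential below
  bound the \<open>R\<close>-prefix directly and the remainder by the induction hypothesis.\<close>

lemma relpow_Un_first:
  assumes "(c, c') \<in> (R \<union> S) ^^ m"
  shows "(c, c') \<in> R ^^ m \<or>
    (\<exists>i j a b. m = i + Suc j \<and> (c, a) \<in> R ^^ i \<and> (a, b) \<in> S \<and> (b, c') \<in> (R \<union> S) ^^ j)"
  using assms
proof (induction m arbitrary: c)
  case 0
  then show ?case by simp
next
  case (Suc m)
  from Suc.prems obtain d where d: "(c, d) \<in> R \<union> S" "(d, c') \<in> (R \<union> S) ^^ m"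
    by (meson relpow_Suc_D2)
  show ?case
  proof (cases "(c, d) \<in> S")
    case True
    have "Suc m = 0 + Suc m" "(c, c) \<in> R ^^ 0" by simp_all
    then show ?thesis using True d(2) by blast
  next
    case False
    then have cd: "(c, d) \<in> R" using d by blast
    from Suc.IH[OF d(2)] show ?thesis
    proof (elim disjE exE conjE)
      assume "(d, c') \<in> R ^^ m"
      then show ?thesis using cd relpow_Suc_I2 by metis
    next
      fix i j a b
      assume *: "m = i + Suc j" "(d, a) \<in> R ^^ i" "(a, b) \<in> S" "(b, c') \<in> (R \<union> S) ^^ j"
      have "Suc m = Suc i + Suc j" using * by simp
      moreover have "(c, a) \<in> R ^^ Suc i" using cd *(2) relpow_Suc_I2 by metis
      ultimately show ?thesis using * by blast
    qed
  qed
qed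

lemma relpow_measure_mono:
  fixes \<phi> :: "'c \<Rightarrow> nat"
  assumes "\<And>c c'. (c, c') \<in> R \<Longrightarrow> \<phi> c' \<le> \<phi> c" and "(c, c') \<in> R ^^ m"
  shows "\<phi> c' \<le> \<phi> c"
  using assms(2) by (induction m arbitrary: c') (auto intro: order_trans assms(1))

lemma relpow_growth:
  fixes s :: "'c \<Rightarrow> nat"
  assumes "\<And>c c'. (c, c') \<in> R \<Longrightarrow> s c' \<le> s c + D" and "(c, c') \<in> R ^^ m"
  shows "s c' \<le> s c + D * m"
  using assms(2)
proof (induction m arbitrary: c')
  case (Suc m)
  then obtain d where "(c, d) \<in> R ^^ m" "(d, c') \<in> R" by auto
  then show ?case using Suc.IH[of d] assms(1)[of d c'] by simp
qed simp

text \<open>Induction on the bound for the potential: after boundedly many \<open>R\<close>-steps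
  the first \<open>S\<close>-step lowers \<phi>, and up to there \<open>s\<close> has grown by a
  bounded amount. As the size bound is re-evaluated after every segment, the result is finite but
  not explicit.\<close>

lemma bounded_runs_Un_finite:
  fixes \<phi> s :: "'c \<Rightarrow> nat"
  assumes R: "\<And>c c'. (c, c') \<in> R \<Longrightarrow> \<phi> c' \<le> \<phi> c"
    and S: "\<And>c c'. (c, c') \<in> S \<Longrightarrow> \<phi> c' < \<phi> c"
    and growth: "\<And>c c'. (c, c') \<in> R \<union> S \<Longrightarrow> s c' \<le> s c + D"
    and bd: "\<And>n. \<exists>l. bounded_runs R {c. s c \<le> n} l"
  shows "\<exists>l. bounded_runs (R \<union> S) {c. s c \<le> n \<and> \<phi> c \<le> r} l"
proof (induction r arbitrary: n rule: less_induct)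
  case (less r)
  obtain l where l: "bounded_runs R {c. s c \<le> n} l" using bd by blast
  \<comment> \<open>Bounds the size after at most \<open>l\<close> steps in \<open>R\<close> and one
    step in \<open>S\<close>.\<close>
  define N where "N = n + D * Suc l"
  \<comment> \<open>One bound has to serve all smaller potentials. The bound for the predecessor of
    \<open>r\<close> does, since its start set contains the others; for \<open>r = 0\<close> there
    is nothing to bound.\<close>
  have "\<exists>l'. \<forall>r'<r. bounded_runs (R \<union> S) {c. s c \<le> N \<and> \<phi> c \<le> r'} l'"
  proof (cases r)
    case (Suc r')
    obtain l' where "bounded_runs (R \<union> S) {c. s c \<le> N \<and> \<phi> c \<le> r'} l'"
      using less.IH[of r' N] Suc by auto
    then have "\<forall>r''<r. bounded_runs (R \<union> S) {c. s c \<le> N \<and> \<phi> c \<le> r''} l'"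
      using Suc unfolding bounded_runs_def by auto
    then show ?thesis by blast
  qed simp
  then obtain l' where l': "\<And>r'. r' < r \<Longrightarrow> bounded_runs (R \<union> S) {c. s c \<le> N \<and> \<phi> c \<le> r'} l'"
    by blast
  have "m \<le> l + Suc l'" if c: "s c \<le> n" "\<phi> c \<le> r" and run: "(c, c') \<in> (R \<union> S) ^^ m" for c c' m
    using relpow_Un_first[OF run]
  proof (elim disjE exE conjE)
    assume "(c, c') \<in> R ^^ m"
    then show ?thesis using bounded_runsD[OF l, of c c' m] c by simp
  next
    fix i j a b
    assume *: "m = i + Suc j" "(c, a) \<in> R ^^ i" "(a, b) \<in> S" "(b, c') \<in> (R \<union> S) ^^ j"
    have i: "i \<le> l" using bounded_runsD[OF l, of c a i] c * by simp
    have "\<phi> a \<le> \<phi> c" using relpow_measure_mono[of R \<phi>, OF R *(2)] by simp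
    then have b1: "\<phi> b < r" using S[OF *(3)] c by simp
    have "s a \<le> s c + D * i" using relpow_growth[OF _ *(2), of s D] growth by blast
    moreover have "s b \<le> s a + D" using growth *(3) by blast
    moreover have "D * i \<le> D * l" using i by (rule mult_le_mono2)
    ultimately have "s b \<le> N" using c(1) unfolding N_def mult_Suc_right by linarith
    then have "j \<le> l'" using bounded_runsD[OF l'[OF b1], of b c' j] *(4) by simp
    then show ?thesis using i * by simp
  qed
  then show ?case unfolding bounded_runs_def by auto
qed

text \<open>If all runs stay in a set on which \<open>R\<close>-segments have length at most
  \<open>l\<close>, there are at most \<open>\<phi> c\<close> steps in \<open>S\<close>, separating
  at most \<open>Suc (\<phi> c)\<close> such segments. This gives an explicit product bound.\<close>

lemma bounded_runs_Un_invariant: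
  fixes \<phi> :: "'c \<Rightarrow> nat"
  assumes R: "\<And>c c'. (c, c') \<in> R \<Longrightarrow> \<phi> c' \<le> \<phi> c"
    and S: "\<And>c c'. (c, c') \<in> S \<Longrightarrow> \<phi> c' < \<phi> c"
    and inv: "\<And>c c'. c \<in> I \<Longrightarrow> (c, c') \<in> R \<union> S \<Longrightarrow> c' \<in> I"
    and bd: "bounded_runs R I l"
    and "c \<in> I" "(c, c') \<in> (R \<union> S) ^^ m"
  shows "m < Suc (\<phi> c) * Suc l"
  using assms(5,6)
proof (induction "\<phi> c" arbitrary: c m rule: less_induct)
  case less
  from relpow_Un_first[OF less.prems(2)] show ?case
  proof (elim disjE exE conjE)
    assume "(c, c') \<in> R ^^ m"
    then have "m \<le> l" using bounded_runsD[OF bd] less.prems by blast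
    then show ?thesis by simp
  next
    fix i j a b
    assume *: "m = i + Suc j" "(c, a) \<in> R ^^ i" "(a, b) \<in> S" "(b, c') \<in> (R \<union> S) ^^ j"
    have i: "i \<le> l" using bounded_runsD[OF bd less.prems(1) *(2)] .
    have "\<phi> a \<le> \<phi> c" using relpow_measure_mono[of R \<phi>, OF R *(2)] by simp
    then have b: "\<phi> b < \<phi> c" using S[OF *(3)] by simp
    have "x \<in> I" if "(c, x) \<in> R ^^ k" for k x
      using that
    proof (induction k arbitrary: x)
      case (Suc k)
      then show ?case using inv by (meson UnI1 relpow_Suc_E)
    qed (use less.prems in simp)
    then have "b \<in> I" using inv * by blast
    then have "j < Suc (\<phi> b) * Suc l" using less.hyps[OF b] * by blast
    also have "\<dots> \<le> \<phi> c * Suc l" using b by (intro mult_right_mono) auto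
    finally show ?thesis using i * by simp
  qed
qed

section \<open>Strongly connected components\<close>

lemma step_iff: "step (Q, T) c c' \<longleftrightarrow> (\<exists>u. (fst c, u, fst c') \<in> T \<and>
     (\<forall>i. int (snd c' $ i) = int (snd c $ i) + u $ i))"
  by (simp add: step_def)

text \<open>A step depends on the transitions alone, so the state set is filled with a dummy.
  Indexing by transition sets turns unions of systems into unions of relations.\<close>

definition step_rel :: "('q, 'd::finite) transition set \<Rightarrow> (('q, 'd) configuration \<times> ('q, 'd) configuration) set"
  where "step_rel T = {(c, c'). step ({}, T) c c'}"

lemma step_rel_Un: "step_rel (S \<union> T) = step_rel S \<union> step_rel T"
  by (auto simp: step_rel_def step_iff)

lemma step_rel_mono: "S \<subseteq> T \<Longrightarrow> step_rel S \<subseteq> step_rel T"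
  by (auto simp: step_rel_def step_iff)

lemma step_rel_UN: "step_rel (\<Union>B\<in>X. F B) = (\<Union>B\<in>X. step_rel (F B))"
  by (auto simp: step_rel_def step_iff)

lemma step_relE:
  assumes "(c, c') \<in> step_rel T"
  obtains u where "(fst c, u, fst c') \<in> T" "\<And>i. int (snd c' $ i) = int (snd c $ i) + u $ i"
  using assms by (auto simp: step_rel_def step_iff)

lemma finite_sccs:
  assumes "finite Q" "finite T"
  shows "finite (sccs (Q, T))"
proof -
  have "sccs (Q, T) \<subseteq> Pow Q \<times> Pow T" by (auto simp: sccs_def sub_vass_def)
  then show ?thesis using assms by (meson finite_Pow_iff finite_SigmaI finite_subset)
qed

lemma sccs_D:
  assumes "B \<in> sccs G"
  shows "is_vass B" "strongly_connected B" "states B \<subseteq> states G" "transitions B \<subseteq> transitions G"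
  using assms by (auto simp: sccs_def sub_vass_def)

lemma sccs_maximal:
  assumes "B \<in> sccs G" "sub_vass C G" "strongly_connected C"
    "states B \<subseteq> states C" "transitions B \<subseteq> transitions C"
  shows "C = B"
  using assms unfolding sccs_def by blast

lemma edges_mono: "transitions A \<subseteq> transitions B \<Longrightarrow> edges A \<subseteq> edges B"
  by (auto simp: edges_def)

text \<open>The union of two strongly connected systems sharing \<open>q\<close> is strongly
  connected by paths through \<open>q\<close>, so maximality makes both equal to their
  union.\<close>

lemma sccs_disjoint:
  assumes B: "B \<in> sccs G" and C: "C \<in> sccs G" and q: "q \<in> states B" "q \<in> states C"
  shows "B = C"
proof -
  define U where "U = (states B \<union> states C, transitions B \<union> transitions C)"
  have eB: "(edges B)\<^sup>+ \<subseteq> (edges U)\<^sup>+" and eC: "(edges C)\<^sup>+ \<subseteq> (edges U)\<^sup>+"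
    by (intro trancl_mono_subset edges_mono; simp add: U_def)+
  have "sub_vass U G"
    unfolding sub_vass_def
  proof (intro conjI)
    show "is_vass U"
      using sccs_D(1)[OF B] sccs_D(1)[OF C] unfolding is_vass_def U_def fst_conv snd_conv
      by (simp add: ball_Un) blast
  qed (use sccs_D(3,4)[OF B] sccs_D(3,4)[OF C] in \<open>simp_all add: U_def\<close>)
  moreover have "strongly_connected U"
  proof -
    have "(x, q) \<in> (edges U)\<^sup>+ \<and> (q, x) \<in> (edges U)\<^sup>+" if "x \<in> states U" for x
      using that sccs_D(2)[OF B] sccs_D(2)[OF C] q eB eC
      unfolding strongly_connected_def U_def by auto
    then show ?thesis unfolding strongly_connected_def by (meson trancl_trans)
  qed
  moreover have "states B \<subseteq> states U" "transitions B \<subseteq> transitions U"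
    "states C \<subseteq> states U" "transitions C \<subseteq> transitions U"
    by (simp_all add: U_def)
  ultimately have "U = B" "U = C" using sccs_maximal B C by blast+
  then show ?thesis by simp
qed

text \<open>The component is the subgraph induced by all states mutually reachable with
  \<open>p\<close>.\<close>

lemma cyclic_transition_in_scc:
  assumes fin: "finite Q" "finite T" and T: "T \<subseteq> Q \<times> UNIV \<times> Q"
    and t: "(p, u, q) \<in> T" and qp: "(q, p) \<in> (edges (Q, T))\<^sup>*"
  shows "\<exists>B\<in>sccs (Q, T). (p, u, q) \<in> transitions B"
proof -
  let ?E = "edges (Q, T)"
  define X where "X = {x \<in> Q. (p, x) \<in> ?E\<^sup>* \<and> (x, p) \<in> ?E\<^sup>*}"
  define B where "B = (X, T \<inter> X \<times> UNIV \<times> X)"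
  have pq: "(p, q) \<in> ?E" using t by (auto simp: edges_def)
  have X: "p \<in> X" "q \<in> X" using t T qp pq by (auto simp: X_def)
  have E_Q: "(x, y) \<in> ?E \<Longrightarrow> x \<in> Q \<and> y \<in> Q" for x y using T by (auto simp: edges_def)
  \<comment> \<open>A path to \<open>p\<close> from a state reachable from \<open>p\<close> visits
    only states mutually reachable with \<open>p\<close>, so it stays inside
    \<open>B\<close>.\<close>
  have to_p: "(x, p) \<in> (edges B)\<^sup>*" if "(x, p) \<in> ?E\<^sup>*" "(p, x) \<in> ?E\<^sup>*" for x
    using that
  proof (induction rule: converse_rtrancl_induct)
    case (step x y)
    have py: "(p, y) \<in> ?E\<^sup>*" using step.prems step.hyps(1) by (rule rtrancl_into_rtrancl)
    have "(x, p) \<in> ?E\<^sup>*" using step.hyps by (rule converse_rtrancl_into_rtrancl)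
    then have "x \<in> X" "y \<in> X" using step.prems step.hyps(2) py E_Q[OF step.hyps(1)] by (simp_all add: X_def)
    then have "(x, y) \<in> edges B" using step(1) by (auto simp: B_def edges_def)
    then show ?case using step.IH[OF py] by (rule converse_rtrancl_into_rtrancl)
  qed simp
  have from_p: "(p, x) \<in> (edges B)\<^sup>*" if "(p, x) \<in> ?E\<^sup>*" "(x, p) \<in> ?E\<^sup>*" for x
    using that
  proof (induction rule: rtrancl_induct)
    case (step x y)
    have xp: "(x, p) \<in> ?E\<^sup>*" using step.hyps(2) step.prems by (rule converse_rtrancl_into_rtrancl)
    have "(p, y) \<in> ?E\<^sup>*" using step.hyps by (rule rtrancl_into_rtrancl)
    then have "x \<in> X" "y \<in> X" using step.prems step.hyps(1) xp E_Q[OF step.hyps(2)] by (simp_all add: X_def)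
    then have "(x, y) \<in> edges B" using step(2) by (auto simp: B_def edges_def)
    with step.IH[OF xp] show ?case by (rule rtrancl_into_rtrancl)
  qed simp
  have pqB: "(p, q) \<in> edges B" using t X by (auto simp: edges_def B_def)
  have "(q, p) \<in> (edges B)\<^sup>*" using to_p X by (auto simp: X_def)
  \<comment> \<open>Strong connectivity asks for nonempty paths; the given transition closes a
    nonempty cycle at \<open>p\<close> through which every pair can be joined.\<close>
  then have pp: "(p, p) \<in> (edges B)\<^sup>+" using pqB by (meson rtrancl_into_trancl2)
  have sc: "strongly_connected B"
    unfolding strongly_connected_def
  proof (intro ballI)
    fix x y assume "x \<in> states B" "y \<in> states B"
    then have "(x, p) \<in> (edges B)\<^sup>*" "(p, y) \<in> (edges B)\<^sup>*"
      using to_p from_p by (auto simp: B_def X_def)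
    then show "(x, y) \<in> (edges B)\<^sup>+"
      using pp by (meson rtrancl_trancl_trancl trancl_rtrancl_trancl)
  qed
  have "\<exists>u y. (x, u, y) \<in> transitions B" if "x \<in> X" for x
  proof -
    have "(x, x) \<in> (edges B)\<^sup>+" using sc that by (auto simp: strongly_connected_def B_def)
    then obtain y where "(x, y) \<in> edges B" by (meson tranclD)
    then show ?thesis by (auto simp: edges_def)
  qed
  then have sub: "sub_vass B (Q, T)"
    using X fin unfolding sub_vass_def is_vass_def by (auto simp: B_def X_def)
  \<comment> \<open>Every state of a strongly connected \<open>C\<close> containing \<open>p\<close>
    is mutually reachable with \<open>p\<close>, so \<open>C\<close> cannot be larger.\<close>
  have "C = B" if C: "sub_vass C (Q, T)" "strongly_connected C"
    and le: "states B \<subseteq> states C" "transitions B \<subseteq> transitions C" for C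
  proof -
    have "(edges C)\<^sup>+ \<subseteq> ?E\<^sup>+"
      using C by (intro trancl_mono_subset edges_mono) (auto simp: sub_vass_def)
    moreover have "p \<in> states C" using le X by (auto simp: B_def)
    ultimately have "(p, x) \<in> ?E\<^sup>+ \<and> (x, p) \<in> ?E\<^sup>+" if "x \<in> states C" for x
      using C(2) that unfolding strongly_connected_def by blast
    then have "states C \<subseteq> X"
      using C(1) unfolding X_def sub_vass_def by (auto dest: trancl_into_rtrancl)
    moreover have "transitions C \<subseteq> T \<inter> states C \<times> UNIV \<times> states C"
      using C by (auto simp: sub_vass_def is_vass_def)
    ultimately show "C = B" using le unfolding B_def by (intro prod_eqI) auto
  qed
  then have "B \<in> sccs (Q, T)" using sub sc unfolding sccs_def by blast
  moreover have "(p, u, q) \<in> transitions B" using t X by (auto simp: B_def)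
  ultimately show ?thesis by blast
qed

text \<open>Consecutive transitions share a state and components are disjoint, so a run inside the
  components never changes component. The empty run is separate because its state may lie in no
  component; the claim on \<open>fst c'\<close> is what the induction needs to attach the next
  step.\<close>

lemma relpow_step_rel_sccs:
  assumes "(c, c') \<in> step_rel (\<Union>B\<in>sccs G. transitions B) ^^ m"
  shows "m = 0 \<or> (\<exists>B\<in>sccs G. fst c' \<in> states B \<and> (c, c') \<in> step_rel (transitions B) ^^ m)"
  using assms
proof (induction m arbitrary: c')
  case (Suc m)
  from Suc.prems obtain d where d: "(c, d) \<in> step_rel (\<Union>B\<in>sccs G. transitions B) ^^ m"
    "(d, c') \<in> step_rel (\<Union>B\<in>sccs G. transitions B)" by (rule relpow_Suc_E)
  then obtain B where B: "B \<in> sccs G" "(d, c') \<in> step_rel (transitions B)"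
    unfolding step_rel_UN by blast
  have st: "fst d \<in> states B" "fst c' \<in> states B"
    using sccs_D(1)[OF B(1)] B(2) unfolding is_vass_def by (blast elim: step_relE)+
  show ?case
  proof (cases "m = 0")
    case True
    then have "(c, c') \<in> step_rel (transitions B) ^^ Suc m" using B d(1) by simp
    then show ?thesis using B(1) st(2) by blast
  next
    case False
    then obtain B' where B': "B' \<in> sccs G" "fst d \<in> states B'" "(c, d) \<in> step_rel (transitions B') ^^ m"
      using Suc.IH[OF d(1)] by blast
    have "B' = B" using sccs_disjoint[OF B'(1) B(1) B'(2) st(1)] .
    then have "(c, c') \<in> step_rel (transitions B) ^^ Suc m" using B B' by (blast intro: relpow_Suc_I)
    then show ?thesis using B(1) st(2) by blast
  qed
qed simp

lemma bounded_runs_sccs: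
  assumes "\<And>B. B \<in> sccs G \<Longrightarrow> bounded_runs (step_rel (transitions B)) X l"
  shows "bounded_runs (step_rel (\<Union>B\<in>sccs G. transitions B)) X l"
  unfolding bounded_runs_def
proof (intro ballI allI impI)
  fix c c' m
  assume c: "c \<in> X" and run: "(c, c') \<in> step_rel (\<Union>B\<in>sccs G. transitions B) ^^ m"
  from relpow_step_rel_sccs[OF run] show "m \<le> l"
    using bounded_runsD[OF assms c, of _ c' m] by (elim disjE bexE conjE) simp_all
qed

section \<open>Potential functions from quasi-ranking functions\<close>

lemma component_le_conf_size: "snd c $ i \<le> conf_size c"
  unfolding conf_size_def by (rule Max_ge) auto

lemma conf_size_leI: "(\<And>i. snd c $ i \<le> n) \<Longrightarrow> conf_size c \<le> n"
  unfolding conf_size_def by (subst Max_le_iff) auto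

lemma step_rel_growth:
  fixes T :: "('q, 'd::finite) transition set"
  assumes "finite T"
  obtains D where "\<And>c c'. (c, c') \<in> step_rel T \<Longrightarrow> conf_size c' \<le> conf_size c + D"
proof
  \<comment> \<open>A crude common bound: the sum of the absolute values of all entries of all
    transitions.\<close>
  let ?D = "\<Sum>t\<in>T. \<Sum>i\<in>UNIV. nat \<bar>fst (snd t) $ i\<bar>"
  fix c c' assume "(c, c') \<in> step_rel T"
  then obtain u where u: "(fst c, u, fst c') \<in> T" "\<And>i. int (snd c' $ i) = int (snd c $ i) + u $ i"
    by (rule step_relE) blast
  show "conf_size c' \<le> conf_size c + ?D"
  proof (rule conf_size_leI)
    fix i
    have "nat \<bar>u $ i\<bar> \<le> (\<Sum>i\<in>UNIV. nat \<bar>u $ i\<bar>)" by (rule member_le_sum) auto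
    also have "\<dots> \<le> ?D"
      using member_le_sum[OF u(1), of "\<lambda>t. \<Sum>i\<in>UNIV. nat \<bar>fst (snd t) $ i\<bar>"] assms by simp
    finally show "snd c' $ i \<le> conf_size c + ?D"
      using u(2)[of i] component_le_conf_size[of c i] by linarith
  qed
qed

text \<open>The floor of the shifted value of \<open>f\<close> keeps equalities and turns a drop by
  at least 1 into a strict decrease. The last property says that it still controls each counter with
  a positive coefficient, since the floor loses less than 1.\<close>

lemma qrf_potential:
  fixes f :: "('q, 'd::finite) linear_map"
  assumes Q: "finite Q" and T: "T \<subseteq> Q \<times> UNIV \<times> Q" and nonneg: "\<And>i. 0 \<le> fst f $ i"
  obtains \<phi> :: "('q, 'd) configuration \<Rightarrow> nat" and C where
    "\<And>c. \<phi> c \<le> C * Suc (conf_size c)"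
    "\<And>c c'. (c, c') \<in> step_rel {t \<in> T. neutral f t} \<Longrightarrow> \<phi> c' = \<phi> c"
    "\<And>c c'. (c, c') \<in> step_rel {t \<in> T. ranked f t} \<Longrightarrow> \<phi> c' < \<phi> c"
    "\<And>c i. fst c \<in> Q \<Longrightarrow> fst f $ i * of_nat (snd c $ i) \<le> of_nat (\<phi> c) + 1"
proof -
  define M where "M = (\<Sum>p\<in>Q. \<bar>snd f p\<bar>)"
  define S where "S = (\<Sum>i\<in>UNIV. fst f $ i)"
  define L where "L = (\<lambda>c::('q, 'd) configuration. \<Sum>i\<in>UNIV. fst f $ i * of_nat (snd c $ i))"
  define g where "g = (\<lambda>c. L c + snd f (fst c) + M)"
  \<comment> \<open>The shift \<open>M\<close> makes \<open>g\<close> nonnegative only on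
    \<open>Q\<close>. Elsewhere the weights are arbitrary, and the value 0 keeps the linear bound
    valid.\<close>
  define \<phi> where "\<phi> = (\<lambda>c. if fst c \<in> Q then nat \<lfloor>g c\<rfloor> else 0)"
  define C where "C = nat \<lceil>S + 2 * M\<rceil>"
  have M: "\<bar>snd f p\<bar> \<le> M" if "p \<in> Q" for p
    unfolding M_def by (rule member_le_sum) (use that Q in auto)
  have M0: "0 \<le> M" unfolding M_def by (simp add: sum_nonneg)
  have S0: "0 \<le> S" unfolding S_def by (simp add: sum_nonneg nonneg)
  have L_ge: "fst f $ i * of_nat (snd c $ i) \<le> L c" for c i
    unfolding L_def by (rule member_le_sum) (auto simp: nonneg)
  have L_le: "L c \<le> S * of_nat (conf_size c)" for c
    unfolding L_def S_def sum_distrib_right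
    by (intro sum_mono mult_left_mono) (auto simp: nonneg component_le_conf_size)
  have L0: "0 \<le> L c" for c
    unfolding L_def by (auto intro!: sum_nonneg simp: nonneg)
  have g_ge: "L c \<le> g c" if "fst c \<in> Q" for c
    using M[OF that] unfolding g_def by linarith
  have L_step: "L c' = L c + dot (fst f) u" if "\<And>i. int (snd c' $ i) = int (snd c $ i) + u $ i" for c c' u
  proof -
    have "(of_nat (snd c' $ i) :: rat) = of_nat (snd c $ i) + of_int (u $ i)" for i
      using arg_cong[OF that[of i], of "of_int :: int \<Rightarrow> rat"] by simp
    then show ?thesis unfolding L_def dot_def by (simp add: distrib_left sum.distrib)
  qed
  show thesis
  proof (rule that[of \<phi> C])
    fix c
    show "\<phi> c \<le> C * Suc (conf_size c)"
    proof (cases "fst c \<in> Q")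
      case True
      have "g c \<le> S * of_nat (conf_size c) + 2 * M"
        using M[OF True] L_le[of c] unfolding g_def by linarith
      also have "\<dots> \<le> (S + 2 * M) * of_nat (Suc (conf_size c))"
        using S0 M0 by (simp add: algebra_simps)
      also have "\<dots> \<le> of_nat C * of_nat (Suc (conf_size c))"
        unfolding C_def by (intro mult_right_mono of_nat_ceiling) simp
      finally have "g c \<le> of_int (int (C * Suc (conf_size c)))" by (simp only: of_nat_mult of_int_mult of_int_of_nat_eq)
      then have "\<lfloor>g c\<rfloor> \<le> int (C * Suc (conf_size c))" by (simp add: floor_le_iff)
      then show ?thesis using True unfolding \<phi>_def by (simp only: if_True nat_le_iff)
    qed (simp add: \<phi>_def)
  next
    fix c c' :: "('q, 'd) configuration"
    assume "(c, c') \<in> step_rel {t \<in> T. neutral f t}"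
    then obtain u where u: "(fst c, u, fst c') \<in> {t \<in> T. neutral f t}"
      "\<And>i. int (snd c' $ i) = int (snd c $ i) + u $ i" by (rule step_relE) blast
    then have "g c' = g c" "fst c \<in> Q" "fst c' \<in> Q"
      using L_step[OF u(2)] T by (auto simp: g_def neutral_def)
    then show "\<phi> c' = \<phi> c" by (simp add: \<phi>_def)
  next
    fix c c' :: "('q, 'd) configuration"
    assume "(c, c') \<in> step_rel {t \<in> T. ranked f t}"
    then obtain u where u: "(fst c, u, fst c') \<in> {t \<in> T. ranked f t}"
      "\<And>i. int (snd c' $ i) = int (snd c $ i) + u $ i" by (rule step_relE) blast
    then have g: "g c' \<le> g c - 1" and Q': "fst c \<in> Q" "fst c' \<in> Q"
      using L_step[OF u(2)] T by (auto simp: g_def ranked_def)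
    \<comment> \<open>Without this, truncation by \<open>nat\<close> could hide the
      decrease.\<close>
    have "0 \<le> g c'" using g_ge[OF Q'(2)] L0[of c'] by linarith
    then show "\<phi> c' < \<phi> c" using g Q' unfolding \<phi>_def by simp linarith
  next
    fix c :: "('q, 'd) configuration" and i
    assume "fst c \<in> Q"
    then have "fst f $ i * of_nat (snd c $ i) \<le> g c" "\<phi> c = nat \<lfloor>g c\<rfloor>"
      using L_ge[of i c] g_ge[of c] by (auto simp: \<phi>_def)
    moreover have "g c \<le> of_nat (nat \<lfloor>g c\<rfloor>) + 1" by linarith
    ultimately show "fst f $ i * of_nat (snd c $ i) \<le> of_nat (\<phi> c) + 1" by simp
  qed
qed

text \<open>The potential counts reachable states. The reachable set shrinks along every transition,
  and strictly if there is no way back, which holds for transitions outside all components.\<close>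

lemma scc_potential:
  fixes Q :: "'q set" and T :: "('q, 'd::finite) transition set"
  assumes fin: "finite Q" "finite T" and T: "T \<subseteq> Q \<times> UNIV \<times> Q"
  obtains \<psi> :: "('q, 'd) configuration \<Rightarrow> nat" where
    "\<And>c. \<psi> c \<le> card Q"
    "\<And>c c'. (c, c') \<in> step_rel T \<Longrightarrow> \<psi> c' \<le> \<psi> c"
    "\<And>c c'. (c, c') \<in> step_rel (T - (\<Union>B\<in>sccs (Q, T). transitions B)) \<Longrightarrow> \<psi> c' < \<psi> c"
proof -
  define reach where "reach = (\<lambda>p. {x \<in> Q. (p, x) \<in> (edges (Q, T))\<^sup>*})"
  define \<psi> where "\<psi> = (\<lambda>c::('q, 'd) configuration. card (reach (fst c)))"
  have fin_reach: "finite (reach p)" for p using fin by (simp add: reach_def)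
  have sub: "reach q \<subseteq> reach p" if "(p, u, q) \<in> T" for p u q
  proof -
    have "(p, q) \<in> edges (Q, T)" using that by (auto simp: edges_def)
    then show ?thesis unfolding reach_def by (auto intro: converse_rtrancl_into_rtrancl)
  qed
  show thesis
  proof (rule that[of \<psi>])
    show "\<psi> c \<le> card Q" for c
      unfolding \<psi>_def by (rule card_mono) (use fin in \<open>auto simp: reach_def\<close>)
  next
    fix c c' :: "('q, 'd) configuration"
    assume "(c, c') \<in> step_rel T"
    then show "\<psi> c' \<le> \<psi> c"
      unfolding \<psi>_def by (elim step_relE) (intro card_mono fin_reach sub)
  next
    fix c c' :: "('q, 'd) configuration"
    assume "(c, c') \<in> step_rel (T - (\<Union>B\<in>sccs (Q, T). transitions B))"
    then obtain u where u: "(fst c, u, fst c') \<in> T - (\<Union>B\<in>sccs (Q, T). transitions B)"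
      by (rule step_relE) blast
    have "(fst c', fst c) \<notin> (edges (Q, T))\<^sup>*"
      using cyclic_transition_in_scc[OF fin T, of "fst c" u "fst c'"] u by blast
    then have "fst c \<notin> reach (fst c')" by (simp add: reach_def)
    moreover have "fst c \<in> reach (fst c)" using u T by (auto simp: reach_def)
    moreover have "reach (fst c') \<subseteq> reach (fst c)" using u sub by blast
    ultimately show "\<psi> c' < \<psi> c"
      unfolding \<psi>_def by (intro psubset_card_mono fin_reach) blast
  qed
qed

text \<open>A transition outside \<open>T1\<close> is either ranked, so that the potential of
  \<open>f\<close> drops, or neutral but leading irrevocably onwards in the neutral graph, so that
  the reachability potential drops.\<close>

lemma neutral_sccs_potential:
  fixes A :: "('q, 'd::finite) vass"
  assumes A: "is_vass A" and f: "qrf A f"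
  defines "T1 \<equiv> \<Union>B\<in>sccs (states A, neutral_transitions A f). transitions B"
  obtains \<phi> :: "('q, 'd) configuration \<Rightarrow> nat" and C where
    "\<And>c. \<phi> c \<le> C * Suc (conf_size c)"
    "\<And>c c'. (c, c') \<in> step_rel T1 \<Longrightarrow> \<phi> c' \<le> \<phi> c"
    "\<And>c c'. (c, c') \<in> step_rel (transitions A - T1) \<Longrightarrow> \<phi> c' < \<phi> c"
proof -
  define N where "N = neutral_transitions A f"
  define P where "P = {t \<in> transitions A. ranked f t}"
  have A': "finite (states A)" "finite (transitions A)" "transitions A \<subseteq> states A \<times> UNIV \<times> states A"
    using A by (auto simp: is_vass_def)
  have N: "finite N" "N \<subseteq> states A \<times> UNIV \<times> states A" "N = {t \<in> transitions A. neutral f t}"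
    using A' by (auto simp: N_def neutral_transitions_def)
  have nonneg: "0 \<le> fst f $ i" for i using f by (simp add: qrf_def)
  have T1_N: "T1 \<subseteq> N" unfolding T1_def by (intro UN_least) (auto simp: N_def dest!: sccs_D(4))
  have "transitions A - T1 \<subseteq> (N - T1) \<union> P"
    using f by (auto simp: N P_def qrf_def)
  then have rest: "step_rel (transitions A - T1) \<subseteq> step_rel (N - T1) \<union> step_rel P"
    unfolding step_rel_Un[symmetric] by (rule step_rel_mono)
  obtain \<phi> C where \<phi>: "\<And>c. \<phi> c \<le> C * Suc (conf_size c)"
    "\<And>c c'. (c, c') \<in> step_rel N \<Longrightarrow> \<phi> c' = \<phi> c"
    "\<And>c c'. (c, c') \<in> step_rel P \<Longrightarrow> \<phi> c' < \<phi> c"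
    by (rule qrf_potential[OF A'(1,3) nonneg, folded N(3) P_def]) blast
  obtain \<psi> :: "('q, 'd) configuration \<Rightarrow> nat" where \<psi>: "\<And>c. \<psi> c \<le> card (states A)"
    "\<And>c c'. (c, c') \<in> step_rel N \<Longrightarrow> \<psi> c' \<le> \<psi> c"
    "\<And>c c'. (c, c') \<in> step_rel (N - T1) \<Longrightarrow> \<psi> c' < \<psi> c"
    by (rule scc_potential[OF A'(1) N(1,2), folded T1_def[folded N_def]]) blast
  let ?q = "Suc (card (states A))"
  \<comment> \<open>Lexicographic combination: a ranked transition may reset \<open>\<psi>\<close>, but by less than the weight of \<open>\<phi>\<close>.\<close>
  define \<xi> where "\<xi> = (\<lambda>c. \<phi> c * ?q + \<psi> c)"
  show thesis
  proof (rule that[of \<xi> "C * ?q + card (states A)"])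
    fix c
    have "\<phi> c * ?q \<le> C * Suc (conf_size c) * ?q" using \<phi>(1) by (rule mult_le_mono1)
    then have "\<xi> c \<le> C * Suc (conf_size c) * ?q + card (states A)" using \<psi>(1)[of c] unfolding \<xi>_def by linarith
    also have "\<dots> \<le> (C * ?q + card (states A)) * Suc (conf_size c)" by (simp add: algebra_simps)
    finally show "\<xi> c \<le> (C * ?q + card (states A)) * Suc (conf_size c)" .
  next
    fix c c' assume "(c, c') \<in> step_rel T1"
    then have "(c, c') \<in> step_rel N" using step_rel_mono[OF T1_N] by blast
    then show "\<xi> c' \<le> \<xi> c" using \<phi>(2) \<psi>(2) by (simp add: \<xi>_def)
  next
    fix c c' assume "(c, c') \<in> step_rel (transitions A - T1)"
    then consider "(c, c') \<in> step_rel (N - T1)" | "(c, c') \<in> step_rel P" using rest by blast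
    then show "\<xi> c' < \<xi> c"
    proof cases
      case 1
      then have "(c, c') \<in> step_rel N" using step_rel_mono[of "N - T1" N] by blast
      then show ?thesis using \<phi>(2) \<psi>(3)[OF 1] by (simp add: \<xi>_def)
    next
      case 2
      have "Suc (\<phi> c') * ?q \<le> \<phi> c * ?q" using \<phi>(3)[OF 2] by (intro mult_le_mono1) simp
      then show ?thesis using \<psi>(1)[of c'] unfolding \<xi>_def by simp
    qed
  qed
qed

text \<open>The potential of \<open>g\<close> starts linear in the size and never increases.
  Positive coefficients make every counter at most a constant multiple of it, up to an additive
  constant.\<close>

lemma positive_qrf_linear_size:
  assumes A: "is_vass A" and g: "positive_qrf A g"
  obtains C where "\<And>c c'. (c, c') \<in> (step_rel (transitions A))\<^sup>* \<Longrightarrow> conf_size c' \<le> C * Suc (conf_size c)"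
proof -
  let ?T = "transitions A"
  have A': "finite (states A)" "?T \<subseteq> states A \<times> UNIV \<times> states A"
    using A by (auto simp: is_vass_def)
  have pos: "0 < fst g $ i" for i using g by (simp add: positive_qrf_def)
  obtain \<phi> C where \<phi>: "\<And>c. \<phi> c \<le> C * Suc (conf_size c)"
    "\<And>c c'. (c, c') \<in> step_rel {t \<in> ?T. neutral g t} \<Longrightarrow> \<phi> c' = \<phi> c"
    "\<And>c c'. (c, c') \<in> step_rel {t \<in> ?T. ranked g t} \<Longrightarrow> \<phi> c' < \<phi> c"
    "\<And>c i. fst c \<in> states A \<Longrightarrow> fst g $ i * of_nat (snd c $ i) \<le> of_nat (\<phi> c) + 1"
    by (rule qrf_potential[OF A' less_imp_le[OF pos]]) blast
  have "?T \<subseteq> {t \<in> ?T. neutral g t} \<union> {t \<in> ?T. ranked g t}"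
    using g unfolding positive_qrf_def qrf_def by blast
  from step_rel_mono[OF this]
  have split: "step_rel ?T \<subseteq> step_rel {t \<in> ?T. neutral g t} \<union> step_rel {t \<in> ?T. ranked g t}"
    unfolding step_rel_Un .
  have dec: "\<phi> c' \<le> \<phi> c" if st: "(c, c') \<in> step_rel ?T" for c c'
  proof -
    consider "(c, c') \<in> step_rel {t \<in> ?T. neutral g t}" | "(c, c') \<in> step_rel {t \<in> ?T. ranked g t}"
      using subsetD[OF split st] by blast
    then show ?thesis by cases (simp_all add: \<phi>(2) \<phi>(3) less_imp_le)
  qed
  have dec_rtrancl: "\<phi> c' \<le> \<phi> c" if "(c, c') \<in> (step_rel ?T)\<^sup>*" for c c'
    using that by (induction rule: rtrancl_induct) (blast intro: dec order_trans)+
  \<comment> \<open>Chosen to dominate the reciprocals of all coefficients at once.\<close>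
  define K where "K = (\<Sum>i\<in>UNIV. nat \<lceil>1 / fst g $ i\<rceil>)"
  have size: "snd c $ i \<le> K * Suc (\<phi> c)" if "fst c \<in> states A" for c i
  proof -
    have "of_nat (snd c $ i) \<le> 1 / fst g $ i * (of_nat (\<phi> c) + 1)"
      using \<phi>(4)[OF that, of i] pos[of i] by (simp add: field_simps)
    also have "\<dots> \<le> of_nat K * (of_nat (\<phi> c) + 1)"
    proof (rule mult_right_mono)
      have "1 / fst g $ i \<le> of_nat (nat \<lceil>1 / fst g $ i\<rceil>)" by (rule of_nat_ceiling)
      also have "\<dots> \<le> of_nat K" unfolding K_def of_nat_le_iff by (rule member_le_sum) auto
      finally show "1 / fst g $ i \<le> of_nat K" .
    qed simp
    finally have "(of_nat (snd c $ i) :: rat) \<le> of_nat (K * Suc (\<phi> c))" by (simp add: algebra_simps)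
    then show ?thesis by (simp only: of_nat_le_iff)
  qed
  show thesis
  proof (rule that[of "Suc (K * Suc C)"])
    fix c c' assume run: "(c, c') \<in> (step_rel ?T)\<^sup>*"
    show "conf_size c' \<le> Suc (K * Suc C) * Suc (conf_size c)"
    \<comment> \<open>The empty run is separate: its state may lie outside \<open>states A\<close>,
      where \<open>size\<close> does not apply. Any other run ends in
      \<open>states A\<close>.\<close>
    proof (cases "c' = c")
      case False
      then obtain d where "(d, c') \<in> step_rel ?T" using run by (blast elim: rtranclE)
      then have "fst c' \<in> states A" using A'(2) by (blast elim: step_relE)
      then have "conf_size c' \<le> K * Suc (\<phi> c')" using size by (intro conf_size_leI) blast
      also have "\<dots> \<le> K * Suc (C * Suc (conf_size c))"
        using dec_rtrancl[OF run] \<phi>(1)[of c] by (intro mult_le_mono2) linarith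
      also have "\<dots> \<le> Suc (K * Suc C) * Suc (conf_size c)" by (simp add: algebra_simps)
      finally show ?thesis .
    qed simp
  qed
qed

section \<open>Run lengths of decomposable systems\<close>

text \<open>Instance of the union argument with \<open>R\<close> the steps inside neutral components
  and \<open>S\<close> all other steps. Sizes are controlled only by the increment of a single
  step.\<close>

lemma bounded_runs_vass:
  fixes A :: "('q, 'd::finite) vass"
  assumes A: "is_vass A" and f: "qrf A f"
    and sccs: "\<And>B n. B \<in> sccs (states A, neutral_transitions A f) \<Longrightarrow>
      \<exists>l. bounded_runs (step_rel (transitions B)) {c. conf_size c \<le> n} l"
  shows "\<exists>l. bounded_runs (step_rel (transitions A)) {c. conf_size c \<le> n} l"
proof -
  let ?X = "sccs (states A, neutral_transitions A f)"
  define T1 where "T1 = (\<Union>B\<in>?X. transitions B)"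
  have fin: "finite (transitions A)" "finite ?X"
    using A by (auto simp: is_vass_def neutral_transitions_def intro!: finite_sccs)
  obtain \<phi> :: "('q, 'd) configuration \<Rightarrow> nat" and C where \<phi>: "\<And>c. \<phi> c \<le> C * Suc (conf_size c)"
    "\<And>c c'. (c, c') \<in> step_rel T1 \<Longrightarrow> \<phi> c' \<le> \<phi> c"
    "\<And>c c'. (c, c') \<in> step_rel (transitions A - T1) \<Longrightarrow> \<phi> c' < \<phi> c"
    by (rule neutral_sccs_potential[OF A f, folded T1_def]) blast
  have "T1 \<subseteq> transitions A"
    unfolding T1_def by (rule UN_least, drule sccs_D(4)) (auto simp: neutral_transitions_def)
  then have split: "step_rel (transitions A) = step_rel T1 \<union> step_rel (transitions A - T1)"
    unfolding step_rel_Un[symmetric] by (simp add: Un_absorb1)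
  obtain D where D: "\<And>c c'. (c, c') \<in> step_rel (transitions A) \<Longrightarrow> conf_size c' \<le> conf_size c + D"
    by (rule step_rel_growth[OF fin(1)]) blast
  have T1: "\<exists>l. bounded_runs (step_rel T1) {c. conf_size c \<le> n} l" for n
  proof -
    have "\<forall>B\<in>?X. \<exists>l. bounded_runs (step_rel (transitions B)) {c. conf_size c \<le> n} l"
      using sccs by (intro ballI)
    from bchoice[OF this] obtain l where
      l: "\<And>B. B \<in> ?X \<Longrightarrow> bounded_runs (step_rel (transitions B)) {c. conf_size c \<le> n} (l B)"
      by (elim exE) (blast dest: bspec)
    \<comment> \<open>There are finitely many components, so the sum of their bounds serves all of
      them.\<close>
    have "bounded_runs (step_rel T1) {c. conf_size c \<le> n} (\<Sum>B\<in>?X. l B)"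
      unfolding T1_def
      by (rule bounded_runs_sccs, rule bounded_runs_mono[OF l], assumption, rule member_le_sum) (use fin in simp_all)
    then show ?thesis by blast
  qed
  have "\<exists>l. bounded_runs (step_rel (transitions A)) {c. conf_size c \<le> n \<and> \<phi> c \<le> C * Suc n} l"
    unfolding split
  proof (rule bounded_runs_Un_finite)
    show "conf_size c' \<le> conf_size c + D"
      if "(c, c') \<in> step_rel T1 \<union> step_rel (transitions A - T1)" for c c'
      using D that unfolding split by blast
  qed (fact \<phi>(2) \<phi>(3) T1)+
  then obtain l where
    "bounded_runs (step_rel (transitions A)) {c. conf_size c \<le> n \<and> \<phi> c \<le> C * Suc n} l" ..
  moreover have "\<phi> c \<le> C * Suc n" if "conf_size c \<le> n" for c
  proof -
    have "C * Suc (conf_size c) \<le> C * Suc n" using that by (intro mult_le_mono2) simp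
    then show ?thesis using \<phi>(1)[of c] by linarith
  qed
  ultimately show ?thesis unfolding bounded_runs_def by blast
qed

text \<open>By the positive function \<open>g\<close>, all configurations along the run have size
  linear in \<open>n\<close>. So each of the linearly many segments has length of order
  \<open>n ^ k\<close>, wherever it starts.\<close>

lemma poly_bounded_runs_vass:
  fixes A :: "('q, 'd::finite) vass"
  assumes A: "is_vass A" and f: "qrf A f" and g: "positive_qrf A g"
    and sccs: "\<And>B. B \<in> sccs (states A, neutral_transitions A f) \<Longrightarrow>
      \<exists>a. \<forall>n. bounded_runs (step_rel (transitions B)) {c. conf_size c \<le> n} (a * Suc n ^ k)"
  shows "\<exists>a. \<forall>n. bounded_runs (step_rel (transitions A)) {c. conf_size c \<le> n} (a * Suc n ^ Suc k)"
proof -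
  let ?X = "sccs (states A, neutral_transitions A f)"
  define T1 where "T1 = (\<Union>B\<in>?X. transitions B)"
  have fin: "finite ?X"
    using A by (auto simp: is_vass_def neutral_transitions_def intro!: finite_sccs)
  obtain \<phi> :: "('q, 'd) configuration \<Rightarrow> nat" and C where \<phi>: "\<And>c. \<phi> c \<le> C * Suc (conf_size c)"
    "\<And>c c'. (c, c') \<in> step_rel T1 \<Longrightarrow> \<phi> c' \<le> \<phi> c"
    "\<And>c c'. (c, c') \<in> step_rel (transitions A - T1) \<Longrightarrow> \<phi> c' < \<phi> c"
    by (rule neutral_sccs_potential[OF A f, folded T1_def]) blast
  have "T1 \<subseteq> transitions A"
    unfolding T1_def by (rule UN_least, drule sccs_D(4)) (auto simp: neutral_transitions_def)
  then have split: "step_rel (transitions A) = step_rel T1 \<union> step_rel (transitions A - T1)"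
    unfolding step_rel_Un[symmetric] by (simp add: Un_absorb1)
  obtain E where E: "\<And>c c'. (c, c') \<in> (step_rel (transitions A))\<^sup>* \<Longrightarrow>
      conf_size c' \<le> E * Suc (conf_size c)"
    by (rule positive_qrf_linear_size[OF A g]) blast
  have "\<forall>B\<in>?X. \<exists>a. \<forall>n. bounded_runs (step_rel (transitions B)) {c. conf_size c \<le> n} (a * Suc n ^ k)"
    using sccs by (intro ballI)
  from bchoice[OF this] obtain a where a: "\<And>B n. B \<in> ?X \<Longrightarrow>
      bounded_runs (step_rel (transitions B)) {c. conf_size c \<le> n} (a B * Suc n ^ k)"
    by (elim exE) (blast dest: bspec)
  define b where "b = (\<Sum>B\<in>?X. a B)"
  have b: "bounded_runs (step_rel T1) {c. conf_size c \<le> n} (b * Suc n ^ k)" for n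
    unfolding T1_def b_def
    by (rule bounded_runs_sccs, rule bounded_runs_mono[OF a], assumption, rule mult_le_mono1,
        rule member_le_sum) (use fin in simp_all)
  have "bounded_runs (step_rel (transitions A)) {c. conf_size c \<le> n}
      (Suc C * Suc (b * Suc E ^ k) * Suc n ^ Suc k)" for n
    unfolding bounded_runs_def
  proof (intro ballI allI impI)
    fix c c' m assume "c \<in> {c. conf_size c \<le> n}" and run: "(c, c') \<in> step_rel (transitions A) ^^ m"
    then have c: "conf_size c \<le> n" by simp
    \<comment> \<open>The invariant is reachability from the fixed start \<open>c\<close>.\<close>
    define I where "I = {d. (c, d) \<in> (step_rel (transitions A))\<^sup>*}"
    define l where "l = b * Suc (E * Suc n) ^ k"
    have "conf_size d \<le> E * Suc n" if "d \<in> I" for d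
    proof -
      have "E * Suc (conf_size c) \<le> E * Suc n" using c by (intro mult_le_mono2) simp
      moreover have "conf_size d \<le> E * Suc (conf_size c)" using E that unfolding I_def by blast
      ultimately show ?thesis by linarith
    qed
    then have bd: "bounded_runs (step_rel T1) I l"
      using b[of "E * Suc n"] unfolding l_def bounded_runs_def by blast
    have inv: "d' \<in> I" if "d \<in> I" "(d, d') \<in> step_rel T1 \<union> step_rel (transitions A - T1)" for d d'
      using that unfolding split[symmetric] I_def by (auto intro: rtrancl_into_rtrancl)
    have "c \<in> I" by (simp add: I_def)
    from bounded_runs_Un_invariant[where \<phi> = \<phi>, OF \<phi>(2,3) inv bd this run[unfolded split]]
    have "m < Suc (\<phi> c) * Suc l" .
    also have "\<dots> \<le> (Suc C * Suc n) * (Suc (b * Suc E ^ k) * Suc n ^ k)"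
    proof (rule mult_le_mono)
      have "C * Suc (conf_size c) \<le> C * Suc n" using c by (intro mult_le_mono2) simp
      then show "Suc (\<phi> c) \<le> Suc C * Suc n" using \<phi>(1)[of c] unfolding mult_Suc by linarith
      \<comment> \<open>Additive constants are absorbed into factors, as \<open>Suc n\<close> is at
        least 1.\<close>
      have "Suc (E * Suc n) ^ k \<le> (Suc E * Suc n) ^ k" by (rule power_mono) auto
      then have "l \<le> b * Suc E ^ k * Suc n ^ k"
        unfolding l_def power_mult_distrib mult.assoc by (rule mult_le_mono2)
      moreover have "1 \<le> Suc n ^ k" by simp
      ultimately have "Suc l \<le> Suc n ^ k + b * Suc E ^ k * Suc n ^ k" by linarith
      then show "Suc l \<le> Suc (b * Suc E ^ k) * Suc n ^ k" by (simp only: mult_Suc)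
    qed
    also have "\<dots> = Suc C * Suc (b * Suc E ^ k) * Suc n ^ Suc k"
      by (simp only: power_Suc mult.assoc mult.commute mult.left_commute)
    finally show "m \<le> Suc C * Suc (b * Suc E ^ k) * Suc n ^ Suc k" by simp
  qed
  then show ?thesis by blast
qed

text \<open>A sub-VASS has a state, and that state has an outgoing transition. Hence the rule
  \<open>one\<close> can be treated as a recursion without components.\<close>

lemma sccs_no_transitions: "sccs (Q, {}) = {}"
  by (auto simp: sccs_def sub_vass_def is_vass_def)

lemma decompose_bounded_runs:
  assumes "decompose A k" "is_vass A" "k \<noteq> \<infinity>"
  shows "\<exists>l. bounded_runs (step_rel (transitions A)) {c. conf_size c \<le> n} l"
  using assms
proof (induction arbitrary: n)
  case (infinite A f)
  then show ?case by simp
next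
  case (one A f)
  show ?case
    by (rule bounded_runs_vass[of A f]) (use one in \<open>auto simp: maximal_qrf_def sccs_no_transitions\<close>)
next
  case (recurse A f K)
  show ?case
  proof (rule bounded_runs_vass[OF recurse.prems(1)])
    show "qrf A f" using recurse.hyps(1) by (simp add: maximal_qrf_def)
    fix B n assume B: "B \<in> sccs (states A, neutral_transitions A f)"
    have "K B \<le> (SUP B\<in>sccs (states A, neutral_transitions A f). K B)" using B by (rule SUP_upper)
    moreover have "(SUP B\<in>sccs (states A, neutral_transitions A f). K B) \<noteq> \<infinity>"
      using recurse.prems(2) by (metis plus_enat_simps(3))
    ultimately have "K B \<noteq> \<infinity>" by (metis enat_ord_simps(5))
    then show "\<exists>l. bounded_runs (step_rel (transitions B)) {c. conf_size c \<le> n} l"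
      using recurse.IH B sccs_D(1)[OF B] by blast
  qed
qed

lemma decompose_poly_bounded_runs:
  assumes "decompose A k" "is_vass A" "positive_qrf A g" "k = enat j"
  shows "\<exists>a. \<forall>n. bounded_runs (step_rel (transitions A)) {c. conf_size c \<le> n} (a * Suc n ^ j)"
  using assms
proof (induction arbitrary: j)
  case (infinite A f)
  then show ?case by simp
next
  case (one A f)
  have "j = Suc 0" using one.prems(3) by (simp add: one_enat_def)
  moreover have "qrf A f" using one.hyps(1) by (simp add: maximal_qrf_def)
  \<comment> \<open>Without components, exponent 0 holds vacuously below, which yields exponent 1
    here.\<close>
  ultimately show ?case
    using poly_bounded_runs_vass[OF one.prems(1) _ one.prems(2), of f 0] one.hyps(3)
    by (simp add: sccs_no_transitions)
next
  case (recurse A f K)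
  let ?X = "sccs (states A, neutral_transitions A f)"
  obtain i where i: "(SUP B\<in>?X. K B) = enat i" "j = Suc i"
  proof (cases "SUP B\<in>?X. K B")
    case (enat i)
    then show ?thesis using recurse.prems(3) that[of i] by (simp add: one_enat_def)
  next
    case infinity
    then show ?thesis using recurse.prems(3) by simp
  qed
  show ?case
    unfolding i(2)
  proof (rule poly_bounded_runs_vass[OF recurse.prems(1) _ recurse.prems(2)])
    show "qrf A f" using recurse.hyps(1) by (simp add: maximal_qrf_def)
    fix B assume B: "B \<in> ?X"
    have "K B \<le> enat i" unfolding i(1)[symmetric] using B by (rule SUP_upper)
    then obtain l where l: "K B = enat l" "l \<le> i" by (cases "K B") auto
    \<comment> \<open>Tightness is decided once for the whole system; \<open>g\<close> restricts to
      every component because its transitions are among those of \<open>A\<close>.\<close>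
    have "positive_qrf B g"
      using recurse.prems(2) sccs_D(4)[OF B] by (auto simp: positive_qrf_def qrf_def neutral_transitions_def)
    then obtain a where a: "\<And>n. bounded_runs (step_rel (transitions B)) {c. conf_size c \<le> n} (a * Suc n ^ l)"
      using recurse.IH B sccs_D(1)[OF B] l(1) by blast
    \<comment> \<open>Components of smaller depth are padded to the common exponent
      \<open>i\<close>.\<close>
    have "bounded_runs (step_rel (transitions B)) {c. conf_size c \<le> n} (a * Suc n ^ i)" for n
      by (rule bounded_runs_mono[OF a mult_le_mono2[OF power_increasing]]) (use l(2) in auto)
    then show "\<exists>a. \<forall>n. bounded_runs (step_rel (transitions B)) {c. conf_size c \<le> n} (a * Suc n ^ i)"
      by blast
  qed
qed

section \<open>The recursion depth\<close>

text \<open>For a strongly connected system these are the functionals that vanish on the effects of all cycles.\<close>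

definition neutral_functionals :: "('q, 'd::finite) vass \<Rightarrow> (real ^ 'd) set" where
  "neutral_functionals A = {c. \<exists>w :: 'q \<Rightarrow> real. \<forall>(p, u, q)\<in>transitions A.
     (\<Sum>i\<in>UNIV. c $ i * of_int (u $ i)) + w q = w p}"

text \<open>Moves the rational coefficients into Euclidean space, where \<open>dim\<close> and
  \<open>span\<close> apply.\<close>

definition real_coeffs :: "('q, 'd::finite) linear_map \<Rightarrow> real ^ 'd" where
  "real_coeffs f = (\<chi> i. of_rat (fst f $ i))"

lemma real_coeffs_in_neutral_functionals_iff:
  "real_coeffs f \<in> neutral_functionals A \<longleftrightarrow>
    (\<exists>w. \<forall>(p, u, q)\<in>transitions A. real_of_rat (dot (fst f) u) + w q = w p)"
  by (simp add: neutral_functionals_def real_coeffs_def dot_def of_rat_sum of_rat_mult)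

lemma subspace_neutral_functionals: "subspace (neutral_functionals A)"
proof (rule subspaceI)
  show "0 \<in> neutral_functionals A"
    unfolding neutral_functionals_def by (auto intro!: exI[of _ "\<lambda>_. 0"])
next
  fix x y assume "x \<in> neutral_functionals A" "y \<in> neutral_functionals A"
  then obtain v w where
    "\<forall>(p, u, q)\<in>transitions A. (\<Sum>i\<in>UNIV. x $ i * of_int (u $ i)) + v q = v p"
    "\<forall>(p, u, q)\<in>transitions A. (\<Sum>i\<in>UNIV. y $ i * of_int (u $ i)) + w q = w p"
    unfolding neutral_functionals_def by blast
  then have "\<forall>(p, u, q)\<in>transitions A.
      (\<Sum>i\<in>UNIV. (x + y) $ i * of_int (u $ i)) + (v q + w q) = v p + w p"
    by (fastforce simp: distrib_right sum.distrib)
  then show "x + y \<in> neutral_functionals A"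
    unfolding neutral_functionals_def by (intro CollectI exI[of _ "\<lambda>p. v p + w p"])
next
  fix r x assume "x \<in> neutral_functionals A"
  then obtain w where w:
    "\<forall>(p, u, q)\<in>transitions A. (\<Sum>i\<in>UNIV. x $ i * of_int (u $ i)) + w q = w p"
    unfolding neutral_functionals_def by blast
  have "(\<Sum>i\<in>UNIV. (r *\<^sub>R x) $ i * of_int (u $ i)) + r * w q = r * w p"
    if "(p, u, q) \<in> transitions A" for p u q
  proof -
    have "(\<Sum>i\<in>UNIV. (r *\<^sub>R x) $ i * of_int (u $ i)) = r * (\<Sum>i\<in>UNIV. x $ i * of_int (u $ i))"
      by (simp add: sum_distrib_left mult.assoc)
    then show ?thesis using w that by (auto simp: distrib_left[symmetric])
  qed
  then show "r *\<^sub>R x \<in> neutral_functionals A"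
    unfolding neutral_functionals_def by (intro CollectI exI[of _ "\<lambda>p. r * w p"]) blast
qed

lemma neutral_functionals_antimono:
  "transitions B \<subseteq> transitions A \<Longrightarrow> neutral_functionals A \<subseteq> neutral_functionals B"
  unfolding neutral_functionals_def by blast

lemma neutral_qrf_in_neutral_functionals:
  assumes "transitions B \<subseteq> neutral_transitions A f"
  shows "real_coeffs f \<in> neutral_functionals B"
proof -
  have "real_of_rat (dot (fst f) u) + of_rat (snd f q) = of_rat (snd f p)"
    if "(p, u, q) \<in> transitions B" for p u q
  proof -
    have "dot (fst f) u + snd f q = snd f p"
      using assms that by (auto simp: neutral_transitions_def neutral_def)
    then show ?thesis by (metis of_rat_add)
  qed
  then show ?thesis
    unfolding real_coeffs_in_neutral_functionals_iff
    by (intro exI[of _ "\<lambda>p. of_rat (snd f p)"]) blast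
qed

text \<open>Otherwise the difference of the two state weights would never increase along a transition and
  strictly decrease along a ranked one, which is impossible on a cycle.\<close>

lemma ranking_qrf_notin_neutral_functionals:
  assumes A: "is_vass A" "strongly_connected A" and f: "qrf A f"
    and ne: "neutral_transitions A f \<noteq> transitions A"
  shows "real_coeffs f \<notin> neutral_functionals A"
proof
  assume "real_coeffs f \<in> neutral_functionals A"
  then obtain w :: "'a \<Rightarrow> real" where
    "\<forall>(p, u, q)\<in>transitions A. real_of_rat (dot (fst f) u) + w q = w p"
    unfolding real_coeffs_in_neutral_functionals_iff by blast
  then have w: "real_of_rat (dot (fst f) u) + w q = w p" if "(p, u, q) \<in> transitions A" for p u q
    using that by blast
  define h where "h = (\<lambda>p. of_rat (snd f p) - w p)"
  have h_ranked: "h q \<le> h p - 1" if "(p, u, q) \<in> transitions A" "ranked f (p, u, q)" for p u q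
  proof -
    have "dot (fst f) u + snd f q \<le> snd f p - 1" using that(2) by (simp add: ranked_def)
    then have "real_of_rat (dot (fst f) u + snd f q) \<le> real_of_rat (snd f p - 1)"
      by (simp only: of_rat_less_eq)
    then show ?thesis using w[OF that(1)] by (simp add: h_def of_rat_add of_rat_diff)
  qed
  have h_neutral: "h q = h p" if "(p, u, q) \<in> transitions A" "neutral f (p, u, q)" for p u q
  proof -
    have "dot (fst f) u + snd f q = snd f p" using that(2) by (simp add: neutral_def)
    then have "real_of_rat (dot (fst f) u) + of_rat (snd f q) = of_rat (snd f p)" by (metis of_rat_add)
    then show ?thesis using w[OF that(1)] by (simp add: h_def)
  qed
  have h_edge: "h q \<le> h p" if e: "(p, q) \<in> edges A" for p q
  proof -
    obtain u where "(p, u, q) \<in> transitions A" using e unfolding edges_def by blast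
    moreover from this have "ranked f (p, u, q) \<or> neutral f (p, u, q)" using f by (auto simp: qrf_def)
    ultimately show ?thesis using h_ranked[of p u q] h_neutral[of p u q] by fastforce
  qed
  have h_path: "h q \<le> h p" if "(p, q) \<in> (edges A)\<^sup>+" for p q
    using that by (induction rule: trancl_induct) (blast intro: h_edge order_trans)+
  obtain p u q where t: "(p, u, q) \<in> transitions A" "\<not> neutral f (p, u, q)"
    using ne unfolding neutral_transitions_def by auto
  then have "ranked f (p, u, q)" using f by (auto simp: qrf_def)
  then have "h q \<le> h p - 1" using h_ranked t by blast
  moreover have "(q, p) \<in> (edges A)\<^sup>+"
    using t(1) A unfolding is_vass_def strongly_connected_def by blast
  then have "h p \<le> h q" by (rule h_path)
  ultimately show False by simp
qed

lemma dim_less_of_subspace: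
  fixes S :: "'a::euclidean_space set"
  assumes "subspace S" "subspace T" "S \<subseteq> T" "x \<in> T" "x \<notin> S"
  shows "dim S < dim T"
proof (rule dim_psubset)
  have "span S = S" "span T = T" using assms(1,2) by (simp_all add: span_eq_iff)
  then show "span S \<subset> span T" using assms(3-5) by blast
qed

text \<open>Strengthens \<open>k \<le> CARD('d)\<close> so that the induction carries: each
  recursive call costs one unit of depth and gains at least one dimension of neutral
  functionals.\<close>

lemma decompose_dim:
  fixes A :: "('q, 'd::finite) vass"
  assumes "decompose A k" "is_vass A" "strongly_connected A" "k \<noteq> \<infinity>"
  shows "k + enat (dim (neutral_functionals A)) \<le> enat CARD('d)"
proof -
  have base: "1 + enat (dim (neutral_functionals A)) \<le> enat CARD('d)"
    if "is_vass A" "strongly_connected A" "maximal_qrf A f" "neutral_transitions A f \<noteq> transitions A"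
    for A :: "('q, 'd) vass" and f
  proof -
    have "real_coeffs f \<notin> neutral_functionals A"
      by (rule ranking_qrf_notin_neutral_functionals) (use that in \<open>auto simp: maximal_qrf_def\<close>)
    then have "dim (neutral_functionals A) < dim (UNIV :: (real ^ 'd) set)"
      by (intro dim_less_of_subspace subspace_neutral_functionals subspace_UNIV) auto
    then show ?thesis by (simp add: one_enat_def)
  qed
  show ?thesis
    using assms
  proof (induction)
    case (infinite A f)
    then show ?case by simp
  next
    case (one A f)
    then show ?case using base by blast
  next
    case (recurse A f K)
    let ?X = "sccs (states A, neutral_transitions A f)"
    have notin: "real_coeffs f \<notin> neutral_functionals A"
      by (rule ranking_qrf_notin_neutral_functionals) (use recurse in \<open>auto simp: maximal_qrf_def\<close>)
    \<comment> \<open>Covers the case without components, where the supremum is 0, and ensures that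
      the subtraction below does not truncate.\<close>
    have dim: "1 + dim (neutral_functionals A) \<le> CARD('d)"
      using base[OF recurse.prems(1,2) recurse.hyps(1,2)] by (simp add: one_enat_def)
    have "K B \<le> enat (CARD('d) - (1 + dim (neutral_functionals A)))" if B: "B \<in> ?X" for B
    proof -
      have "K B \<le> (SUP B\<in>?X. K B)" using B by (rule SUP_upper)
      moreover have "(SUP B\<in>?X. K B) \<noteq> \<infinity>" using recurse.prems(3) by (metis plus_enat_simps(3))
      ultimately have "K B \<noteq> \<infinity>" by (metis enat_ord_simps(5))
      then have KB: "K B + enat (dim (neutral_functionals B)) \<le> enat CARD('d)"
        using recurse.IH B sccs_D(1,2)[OF B] by blast
      have sub: "transitions B \<subseteq> neutral_transitions A f" using sccs_D(4)[OF B] by simp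
      then have "transitions B \<subseteq> transitions A" by (auto simp: neutral_transitions_def)
      \<comment> \<open>The coefficients of \<open>f\<close> witness strictness: they are neutral on
        \<open>B\<close> but not on \<open>A\<close>.\<close>
      then have "dim (neutral_functionals A) < dim (neutral_functionals B)"
        by (intro dim_less_of_subspace[OF _ _ _ neutral_qrf_in_neutral_functionals[OF sub] notin]
            subspace_neutral_functionals neutral_functionals_antimono)
      then show ?thesis using KB by (cases "K B") auto
    qed
    then have "(SUP B\<in>?X. K B) \<le> enat (CARD('d) - (1 + dim (neutral_functionals A)))"
      by (rule SUP_least)
    then show ?case using dim by (cases "SUP B\<in>?X. K B") (auto simp: one_enat_def)
  qed
qed

lemma decompose_ge_1: "decompose A k \<Longrightarrow> 1 \<le> k"
  by (cases rule: decompose.cases) auto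

section \<open>Termination complexity\<close>

lemma computation_relpow:
  assumes "computation A c n cs"
  shows "(c, cs ! n) \<in> step_rel (transitions A) ^^ n"
  unfolding relpow_fun_conv
proof (intro exI[of _ "\<lambda>i. cs ! i"] conjI allI impI)
  show "cs ! 0 = c" using assms by (simp add: computation_def)
  show "(cs ! i, cs ! Suc i) \<in> step_rel (transitions A)" if "i < n" for i
    using assms that by (simp add: computation_def step_rel_def step_def)
qed simp

lemma termination_complexity_le:
  assumes "bounded_runs (step_rel (transitions A)) {c. conf_size c \<le> n} l"
  shows "termination_complexity A n \<le> enat l"
  unfolding termination_complexity_def
proof (rule Sup_least, clarify)
  fix p :: 'a and v :: "(nat, 'b) vec"
  assume n: "n = conf_size (p, v)"
  show "termination_time A (p, v) \<le> enat l"
    unfolding termination_time_def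
  proof (rule Sup_least, clarify)
    fix m cs assume run: "computation A (p, v) m cs"
    have "m \<le> l" by (rule bounded_runsD[OF assms _ computation_relpow[OF run]]) (simp add: n)
    then show "enat m \<le> enat l" by simp
  qed
qed

theorem mainTheorem5:
  fixes A :: "('q, 'd::finite) vass" and k :: nat and tight :: bool
  assumes "is_vass A"
    and "strongly_connected A"
    and "transitions A \<noteq> {}"
    and "algorithm_returns A (Bound k tight)"
  shows "k \<in> {1..CARD('d)} \<and> terminating A \<and>
    (tight \<longrightarrow> in_bigo (termination_complexity A) (\<lambda>n. real n ^ k))"
proof -
  have dec: "decompose A (enat k)" and tight: "tight \<longleftrightarrow> (\<exists>f. positive_qrf A f)"
    using assms(4) by (auto simp: algorithm_returns_def split: enat.splits)
  have "enat k + enat (dim (neutral_functionals A)) \<le> enat CARD('d)"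
    using decompose_dim[OF dec assms(1,2)] by simp
  moreover have "1 \<le> k" using decompose_ge_1[OF dec] by (simp add: one_enat_def)
  ultimately have k: "k \<in> {1..CARD('d)}" by simp
  have "termination_complexity A n < \<infinity>" for n
  proof -
    obtain l where "bounded_runs (step_rel (transitions A)) {c. conf_size c \<le> n} l"
      using decompose_bounded_runs[OF dec assms(1)] by auto
    then have "termination_complexity A n \<le> enat l" by (rule termination_complexity_le)
    then show ?thesis by (rule order.strict_trans1) simp
  qed
  then have terminating: "terminating A" by (simp add: terminating_def)
  have "in_bigo (termination_complexity A) (\<lambda>n. real n ^ k)" if tight
  proof -
    obtain g where "positive_qrf A g" using \<open>tight\<close> tight by blast
    then obtain a where a: "\<And>n. bounded_runs (step_rel (transitions A)) {c. conf_size c \<le> n} (a * Suc n ^ k)"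
      using decompose_poly_bounded_runs[OF dec assms(1)] by blast
    \<comment> \<open>For positive \<open>n\<close>, \<open>Suc n\<close> is at most
      \<open>2 * n\<close>, whence the factor \<open>2 ^ k\<close>. The outer \<open>Suc\<close>
      keeps the constant positive even if \<open>a = 0\<close>.\<close>
    have "ereal_of_enat (termination_complexity A n) \<le> ereal (real (Suc (a * 2 ^ k)) * real n ^ k)"
      if "1 \<le> n" for n
    proof -
      have "a * Suc n ^ k \<le> a * (2 * n) ^ k" using that by (intro mult_le_mono2 power_mono) auto
      also have "\<dots> \<le> Suc (a * 2 ^ k) * n ^ k" by (simp add: power_mult_distrib)
      finally have "enat (a * Suc n ^ k) \<le> enat (Suc (a * 2 ^ k) * n ^ k)" by simp
      with termination_complexity_le[OF a[of n]]
      have "termination_complexity A n \<le> enat (Suc (a * 2 ^ k) * n ^ k)" by (rule order_trans)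
      then have "ereal_of_enat (termination_complexity A n) \<le> ereal_of_enat (enat (Suc (a * 2 ^ k) * n ^ k))"
        by (simp only: ereal_of_enat_le_iff)
      also have "\<dots> = ereal (real (Suc (a * 2 ^ k)) * real n ^ k)"
        by (simp only: ereal_of_enat_simps of_nat_mult of_nat_power)
      finally show ?thesis .
    qed
    moreover have "0 < real (Suc (a * 2 ^ k))" by (rule of_nat_0_less_iff[THEN iffD2]) simp
    ultimately show ?thesis
      unfolding in_bigo_def by (blast intro: eventually_sequentiallyI)
  qed
  then show ?thesis using k terminating by blast
qed

end
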